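(* For every integer $k \geq 2$ there exists a constructible $2$-dimensional simplicial complex $\Delta_k$ that is not ridge-chordal, such that the Alexander dual of the clique complex $\operatorname{Cl}(\Delta_k)$ is pure of dimension $5k-2$, shellable, and $4$-decomposable.
   Context: All simplicial complexes are finite, on a vertex set $[n]=\{1,\dots,n\}$. A complex is pure if all its facets have the same dimension. For a pure $d$-dimensional complex $\Delta$, a ridge is a $(d-1)$-dimensional face. A clique of $\Delta$ is a subset $V\subseteq[n]$ such that every subset of $V$ of size $d+1$ is a facet of $\Delta$ (in particular every subset of size at most $d$ is a clique). The clique complex $\operatorname{Cl}(\Delta)$ is the simplicial complex on $[n]$ whose faces are the cliques of $\Delta$. The star $\operatorname{Star}(r,\Delta)$ of a face $r$ is the subcomplex generated by the facets containing $r$. A pure $d$-dimensional complex $\Delta$ is ridge-chordal if it can be reduced to the empty set by repeatedly deleting a ridge $r$ (i.e. removing all faces containing $r$) such that the set of vertices of the star of $r$ in the current complex is a clique of the current complex. The Alexander dual of a complex $\Gamma$ on $[n]$ is $\{\sigma\subseteq[n] : [n]\setminus\sigma\notin\Gamma\}$. For a face $\sigma$ of $\Delta$: $\operatorname{link}_\Delta(\sigma)=\{\tau\in\Delta : \sigma\cap\tau=\emptyset,\ \sigma\cup\tau\subseteq F \text{ for some facet } F\}$ and $\operatorname{del}_\Delta(\sigma)=\{\tau\in\Delta:\sigma\not\subseteq\tau\}$. A face $\sigma$ of a pure complex $\Delta$ is a shedding face if $\operatorname{del}_\Delta(\sigma)$ is pure (of the same dimension). A pure complex $\Delta$ is $k$-decomposable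 if $\Delta$ is a simplex, or there is a shedding face $\sigma$ with $\dim\sigma\le k$ such that $\operatorname{link}_\Delta(\sigma)$ and $\operatorname{del}_\Delta(\sigma)$ are both $k$-decomposable. A pure $d$-dimensional complex with $N$ facets is constructible if either $d(N-1)=0$, or $\Delta=\Delta_1\cup\Delta_2$ with $\Delta_1,\Delta_2$ constructible $d$-dimensional complexes and $\Delta_1\cap\Delta_2$ a constructible $(d-1)$-dimensional complex. Shellability is the standard notion for pure simplicial complexes. *)

theory Defs
  imports Complex_Main
begin

(* Complexes are sets of faces. The empty face belongs to every complex except the void complex {},
   and has dimension -1; hence dimensions are integers. *)

definition simplicial_complex :: "'a set set \<Rightarrow> bool" where
  "simplicial_complex K \<longleftrightarrow>
     finite K \<and> (\<forall>\<sigma>\<in>K. finite \<sigma>) \<and> (\<forall>\<sigma>\<in>K. \<forall>\<tau>. \<tau> \<subseteq> \<sigma> \<longrightarrow> \<tau> \<in> K)"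

definition vertices :: "'a set set \<Rightarrow> 'a set" where
  "vertices K = \<Union>K"

definition dim_face :: "'a set \<Rightarrow> int" where
  "dim_face \<sigma> = int (card \<sigma>) - 1"

definition facets :: "'a set set \<Rightarrow> 'a set set" where
  "facets K = {F \<in> K. \<forall>\<sigma>\<in>K. F \<subseteq> \<sigma> \<longrightarrow> \<sigma> = F}"

(* The void complex is not pure of any dimension; {{}} is pure of dimension -1. *)
definition pure_complex :: "int \<Rightarrow> 'a set set \<Rightarrow> bool" where
  "pure_complex d K \<longleftrightarrow>
     simplicial_complex K \<and> K \<noteq> {} \<and> (\<forall>F\<in>facets K. dim_face F = d)"

definition star :: "'a set \<Rightarrow> 'a set set \<Rightarrow> 'a set set" where
  "star r K = {\<tau>. \<exists>F\<in>facets K. r \<subseteq> F \<and> \<tau> \<subseteq> F}"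

definition link :: "'a set \<Rightarrow> 'a set set \<Rightarrow> 'a set set" where
  "link \<sigma> K = {\<tau>\<in>K. \<sigma> \<inter> \<tau> = {} \<and> (\<exists>F\<in>facets K. \<sigma> \<union> \<tau> \<subseteq> F)}"

definition deletion :: "'a set \<Rightarrow> 'a set set \<Rightarrow> 'a set set" where
  "deletion \<sigma> K = {\<tau>\<in>K. \<not> \<sigma> \<subseteq> \<tau>}"

definition clique :: "nat \<Rightarrow> int \<Rightarrow> nat set set \<Rightarrow> nat set \<Rightarrow> bool" where
  "clique n d K V \<longleftrightarrow> V \<subseteq> {1..n} \<and> (\<forall>\<tau>\<subseteq>V. int (card \<tau>) = d + 1 \<longrightarrow> \<tau> \<in> facets K)"

definition clique_complex :: "nat \<Rightarrow> int \<Rightarrow> nat set set \<Rightarrow> nat set set" where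
  "clique_complex n d K = {V. clique n d K V}"

definition alexander_dual :: "nat \<Rightarrow> nat set set \<Rightarrow> nat set set" where
  "alexander_dual n K = {\<sigma>. \<sigma> \<subseteq> {1..n} \<and> {1..n} - \<sigma> \<notin> K}"

(* The dimension d is that of the initial complex throughout. Deleting ridges never removes the
   faces of dimension below d - 1 (for instance the vertices when d = 2), so "reduced to the empty
   set" refers to the d-dimensional faces. Ridges left without a d-dimensional coface may still be
   deleted: such a ridge is its own star, which is vacuously a clique. *)
inductive ridge_reducible :: "nat \<Rightarrow> int \<Rightarrow> nat set set \<Rightarrow> bool" for n :: nat and d :: int where
  reduced: "(\<And>\<sigma>. \<sigma> \<in> K \<Longrightarrow> dim_face \<sigma> \<noteq> d) \<Longrightarrow> ridge_reducible n d K"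
| delete_ridge: "r \<in> K \<Longrightarrow> dim_face r = d - 1 \<Longrightarrow> clique n d K (vertices (star r K)) \<Longrightarrow>
    ridge_reducible n d (deletion r K) \<Longrightarrow> ridge_reducible n d K"

definition ridge_chordal :: "nat \<Rightarrow> int \<Rightarrow> nat set set \<Rightarrow> bool" where
  "ridge_chordal n d K \<longleftrightarrow> pure_complex d K \<and> ridge_reducible n d K"

inductive constructible :: "int \<Rightarrow> 'a set set \<Rightarrow> bool" where
  base: "pure_complex d K \<Longrightarrow> d * (int (card (facets K)) - 1) = 0 \<Longrightarrow> constructible d K"
| union: "pure_complex d (K1 \<union> K2) \<Longrightarrow> constructible d K1 \<Longrightarrow> constructible d K2 \<Longrightarrow>
    constructible (d - 1) (K1 \<inter> K2) \<Longrightarrow> constructible d (K1 \<union> K2)"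

definition shellable :: "'a set set \<Rightarrow> bool" where
  "shellable K \<longleftrightarrow> (\<exists>d. pure_complex d K \<and>
     (\<exists>Fs. distinct Fs \<and> set Fs = facets K \<and>
        (\<forall>j. 0 < j \<and> j < length Fs \<longrightarrow>
           pure_complex (d - 1) ((\<Union>i<j. Pow (Fs ! i)) \<inter> Pow (Fs ! j)))))"

definition shedding_face :: "'a set \<Rightarrow> 'a set set \<Rightarrow> bool" where
  "shedding_face \<sigma> K \<longleftrightarrow> \<sigma> \<in> K \<and> (\<exists>d. pure_complex d K \<and> pure_complex d (deletion \<sigma> K))"

inductive decomposable :: "nat \<Rightarrow> 'a set set \<Rightarrow> bool" for k :: nat where
  simplex: "finite F \<Longrightarrow> decomposable k (Pow F)"
| shed: "shedding_face \<sigma> K \<Longrightarrow> dim_face \<sigma> \<le> int k \<Longrightarrow>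
    decomposable k (link \<sigma> K) \<Longrightarrow> decomposable k (deletion \<sigma> K) \<Longrightarrow> decomposable k K"

end

theory Submission
  imports Defs
begin

text \<open>Take a shellable contractible 2-complex on 7 vertices, the block, with exactly one free edge, and
  glue k copies of it along that edge; this gives 5k + 2 vertices. The intersections are single
  edges, so the result is constructible, and since no edge is free and no star spans a clique, no
  ridge can be deleted.

  The facets of the Alexander dual are the complements of the triples that are not triangles, so
  shedding faces and shellings of the dual are conditions on this family N of triples.
  A nonempty set s sheds if each T in N disjoint from s and each x in s admit a member of N that
  contains x and lies in T + x; the link belongs to the members of N disjoint from s, the deletion to
  the others. In the glued complex the five private vertices of the last copy shed: the link is the
  dual for one copy fewer, and in the deletion the vertices of the other copies shed one at a time,
  until only the nonfaces of a single block remain.\<close>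

section \<open>Complexes generated by their facets\<close>

definition generated :: "'a set set \<Rightarrow> 'a set set" where
  "generated Fs = \<Union>(Pow ` Fs)"

lemma mem_generated: "\<tau> \<in> generated Fs \<longleftrightarrow> (\<exists>F\<in>Fs. \<tau> \<subseteq> F)"
  by (auto simp: generated_def)

lemma generated_insert: "generated (insert F Fs) = generated Fs \<union> Pow F"
  by (auto simp: generated_def)

lemma generated_Un: "generated (Fs \<union> Gs) = generated Fs \<union> generated Gs"
  by (auto simp: generated_def)

definition uniform :: "nat \<Rightarrow> 'a set set \<Rightarrow> bool" where
  "uniform c Fs \<longleftrightarrow> finite Fs \<and> (\<forall>F\<in>Fs. finite F \<and> card F = c)"

text \<open>Among finite sets of equal cardinality inclusion forces equality, so no generator
  absorbs another.\<close>

lemma facets_generated: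
  assumes "uniform c Fs"
  shows "facets (generated Fs) = Fs"
proof -
  have eq: "F = G" if "F \<in> Fs" "G \<in> Fs" "F \<subseteq> G" for F G
    using that assms card_subset_eq[of G F] by (simp add: uniform_def)
  show ?thesis
  proof (intro equalityI subsetI)
    fix F assume F: "F \<in> facets (generated Fs)"
    then obtain G where G: "G \<in> Fs" "F \<subseteq> G" by (auto simp: facets_def mem_generated)
    then have "G \<in> generated Fs" by (auto simp: mem_generated)
    then have "G = F" using F G(2) by (simp add: facets_def)
    then show "F \<in> Fs" using G(1) by simp
  next
    fix F assume F: "F \<in> Fs"
    have "\<sigma> = F" if \<sigma>: "\<sigma> \<in> generated Fs" "F \<subseteq> \<sigma>" for \<sigma>
    proof -
      obtain G where G: "G \<in> Fs" "\<sigma> \<subseteq> G" using \<sigma>(1) by (auto simp: mem_generated)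
      then have "F = G" using eq[OF F G(1)] \<sigma>(2) by simp
      then show ?thesis using \<sigma>(2) G(2) by simp
    qed
    then show "F \<in> facets (generated Fs)" using F by (auto simp: facets_def mem_generated)
  qed
qed

lemma simplicial_complex_generated:
  assumes "finite Fs" "\<And>F. F \<in> Fs \<Longrightarrow> finite F"
  shows "simplicial_complex (generated Fs)"
proof -
  have "finite \<sigma>" if "\<sigma> \<in> generated Fs" for \<sigma>
    using that assms(2) by (meson finite_subset mem_generated)
  moreover have "finite (generated Fs)" using assms by (simp add: generated_def)
  ultimately show ?thesis unfolding simplicial_complex_def by (meson mem_generated subset_trans)
qed

lemma pure_complex_generated:
  assumes "uniform c Fs" "Fs \<noteq> {}"
  shows "pure_complex (int c - 1) (generated Fs)"
proof -
  have "simplicial_complex (generated Fs)"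
    using assms(1) by (intro simplicial_complex_generated) (auto simp: uniform_def)
  moreover have "generated Fs \<noteq> {}" using assms(2) by (auto simp: generated_def)
  moreover have "dim_face F = int c - 1" if "F \<in> Fs" for F
    using that assms(1) by (simp add: uniform_def dim_face_def)
  ultimately show ?thesis by (simp add: pure_complex_def facets_generated[OF assms(1)])
qed

section \<open>Complexes generated by complements\<close>

text \<open>The ground set is a parameter of its own because a link removes vertices from
  \<open>W\<close> while it keeps the sets of \<open>N\<close> that avoid the face.\<close>

definition dual_complex :: "'a set \<Rightarrow> 'a set set \<Rightarrow> 'a set set" where
  "dual_complex W N = generated ((\<lambda>T. W - T) ` N)"

lemma mem_dual_complex: "\<tau> \<in> dual_complex W N \<longleftrightarrow> (\<exists>T\<in>N. \<tau> \<subseteq> W - T)"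
  by (auto simp: dual_complex_def mem_generated)

lemma uniform_complements:
  assumes "finite W" "\<And>T. T \<in> N \<Longrightarrow> T \<subseteq> W \<and> card T = c"
  shows "uniform (card W - c) ((\<lambda>T. W - T) ` N)"
proof -
  have "N \<subseteq> Pow W" using assms by auto
  then have "finite N" using assms(1) by (simp add: finite_subset)
  moreover have "card (W - T) = card W - c" if "T \<in> N" for T
    using assms that by (metis card_Diff_subset finite_subset)
  ultimately show ?thesis using assms(1) by (simp add: uniform_def)
qed

lemma pure_dual_complex:
  assumes "finite W" "\<And>T. T \<in> N \<Longrightarrow> T \<subseteq> W \<and> card T = c" "N \<noteq> {}"
  shows "pure_complex (int (card W - c) - 1) (dual_complex W N)"
  unfolding dual_complex_def
proof (rule pure_complex_generated)
  show "uniform (card W - c) ((\<lambda>T. W - T) ` N)" by (rule uniform_complements[OF assms(1,2)])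
  show "(\<lambda>T. W - T) ` N \<noteq> {}" using assms(3) by simp
qed

section \<open>Decomposability and linear quotients of nonface families\<close>

text \<open>\<open>N\<close> stands for the complex with facets \<open>W - T\<close>; a single set
  gives a simplex. The fourth condition of \<open>shed\<close> is purity of the deletion: if
  \<open>W - T\<close> contains \<open>\<sigma>\<close>, each face \<open>W - T - {s}\<close> must
  lie in a facet \<open>W - T'\<close> that lacks \<open>s\<close>.\<close>

inductive nonface_decomposable :: "nat \<Rightarrow> 'a set set \<Rightarrow> bool" for k :: nat where
  single: "nonface_decomposable k {T}"
| shed: "\<sigma> \<noteq> {} \<Longrightarrow> finite \<sigma> \<Longrightarrow> card \<sigma> \<le> k + 1 \<Longrightarrow>
    (\<And>T s. T \<in> N \<Longrightarrow> T \<inter> \<sigma> = {} \<Longrightarrow> s \<in> \<sigma> \<Longrightarrow> \<exists>T'\<in>N. s \<in> T' \<and> T' \<subseteq> insert s T) \<Longrightarrow>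
    nonface_decomposable k {T \<in> N. T \<inter> \<sigma> = {}} \<Longrightarrow>
    nonface_decomposable k {T \<in> N. T \<inter> \<sigma> \<noteq> {}} \<Longrightarrow> nonface_decomposable k N"

lemma nonface_decomposable_nonempty: "nonface_decomposable k N \<Longrightarrow> N \<noteq> {}"
  by (induction rule: nonface_decomposable.induct) auto

text \<open>The complements of sets avoiding \<open>\<sigma>\<close> are the facets containing
  \<open>\<sigma>\<close>. They make up the link, whose ground set is \<open>W - \<sigma>\<close>;
  hence \<open>W\<close> varies in the induction. The other sets generate the deletion.\<close>

lemma decomposable_dual_complex:
  assumes "nonface_decomposable k N" "finite W" "\<And>T. T \<in> N \<Longrightarrow> T \<subseteq> W \<and> card T = c"
  shows "decomposable k (dual_complex W N)"
  using assms
proof (induction arbitrary: W rule: nonface_decomposable.induct)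
  case (single T)
  have "dual_complex W {T} = Pow (W - T)" by (auto simp: dual_complex_def generated_def)
  then show ?case using single by (simp add: decomposable.simplex)
next
  case (shed \<sigma> N)
  let ?L = "{T \<in> N. T \<inter> \<sigma> = {}}" and ?M = "{T \<in> N. T \<inter> \<sigma> \<noteq> {}}"
  \<comment> \<open>This set serves twice: the shedding condition at \<open>T0\<close> puts every
    point of \<open>\<sigma>\<close> into \<open>W\<close>, and its complement shows that
    \<open>\<sigma>\<close> is a face.\<close>
  obtain T0 where T0: "T0 \<in> ?L" using nonface_decomposable_nonempty[OF shed.hyps(5)] by auto
  have sW: "\<sigma> \<subseteq> W"
  proof
    fix s assume "s \<in> \<sigma>"
    then obtain T' where "T' \<in> N" "s \<in> T'" using shed.hyps(4)[of T0 s] T0 by auto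
    then show "s \<in> W" using shed.prems(2) by auto
  qed
  have fac: "facets (dual_complex W N) = (\<lambda>T. W - T) ` N"
    unfolding dual_complex_def using facets_generated[OF uniform_complements] shed.prems by blast
  have lk: "link \<sigma> (dual_complex W N) = dual_complex (W - \<sigma>) ?L"
  proof (intro equalityI subsetI)
    fix \<tau> assume "\<tau> \<in> link \<sigma> (dual_complex W N)"
    then obtain T where "T \<in> N" "\<sigma> \<union> \<tau> \<subseteq> W - T" "\<sigma> \<inter> \<tau> = {}" by (auto simp: link_def fac)
    then show "\<tau> \<in> dual_complex (W - \<sigma>) ?L" unfolding mem_dual_complex by (intro bexI[of _ T]) auto
  next
    fix \<tau> assume "\<tau> \<in> dual_complex (W - \<sigma>) ?L"
    then obtain T where T: "T \<in> N" "T \<inter> \<sigma> = {}" "\<tau> \<subseteq> W - \<sigma> - T" by (auto simp: mem_dual_complex)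
    then have "\<sigma> \<inter> \<tau> = {}" "\<sigma> \<union> \<tau> \<subseteq> W - T" using sW by auto
    then show "\<tau> \<in> link \<sigma> (dual_complex W N)" using T(1) by (auto simp: link_def fac mem_dual_complex)
  qed
  have del: "deletion \<sigma> (dual_complex W N) = dual_complex W ?M"
  proof (intro equalityI subsetI)
    fix \<tau> assume "\<tau> \<in> deletion \<sigma> (dual_complex W N)"
    then obtain T s where T: "T \<in> N" "\<tau> \<subseteq> W - T" "s \<in> \<sigma>" "s \<notin> \<tau>"
      by (auto simp: deletion_def mem_dual_complex)
    \<comment> \<open>If \<open>T\<close> avoids \<open>\<sigma>\<close>, it is exchanged for some
      \<open>T'\<close> inside \<open>insert s T\<close>, which is still disjoint from
      \<open>\<tau>\<close> because \<open>s\<close> is missing from \<open>\<tau>\<close>.\<close>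
    show "\<tau> \<in> dual_complex W ?M"
    proof (cases "T \<inter> \<sigma> = {}")
      case True
      then obtain T' where "T' \<in> N" "s \<in> T'" "T' \<subseteq> insert s T"
        using shed.hyps(4) T by blast
      then show ?thesis using T by (auto simp: mem_dual_complex intro!: exI[of _ T'])
    qed (use T in \<open>auto simp: mem_dual_complex\<close>)
  qed (auto simp: deletion_def mem_dual_complex)
  have "?M \<noteq> {}" using nonface_decomposable_nonempty[OF shed.hyps(6)] by auto
  then have "shedding_face \<sigma> (dual_complex W N)"
    unfolding shedding_face_def del
    using T0 sW pure_dual_complex[of W N c] pure_dual_complex[of W ?M c] shed.prems
    by (auto simp: mem_dual_complex)
  moreover have "decomposable k (link \<sigma> (dual_complex W N))"
    unfolding lk using shed.prems by (intro shed.IH) auto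
  moreover have "decomposable k (deletion \<sigma> (dual_complex W N))"
    unfolding del using shed.prems by (intro shed.IH) auto
  ultimately show ?case
    using shed.hyps(3) by (auto simp: dim_face_def intro: decomposable.shed[of \<sigma>])
qed

text \<open>The newest generator is the head of the list.\<close>
fun linear_quotients :: "'a set list \<Rightarrow> bool" where
  "linear_quotients [] \<longleftrightarrow> True"
| "linear_quotients (T # Ts) \<longleftrightarrow> linear_quotients Ts \<and>
     (\<forall>T1\<in>set Ts. \<exists>x\<in>T1 - T. \<exists>T2\<in>set Ts. T2 \<subseteq> insert x T)"

lemma linear_quotients_distinct: "linear_quotients Ts \<Longrightarrow> distinct Ts"
  by (induction Ts) auto

text \<open>The sets of \<open>Us\<close> are older. Comparisons within each list are given, so only
  those of a set in \<open>Ts\<close> with a set in \<open>Us\<close> have to be assumed.\<close>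

lemma linear_quotients_append:
  assumes "linear_quotients Ts" "linear_quotients Us"
    and "\<And>T U. T \<in> set Ts \<Longrightarrow> U \<in> set Us \<Longrightarrow> \<exists>x\<in>U - T. \<exists>V\<in>set Us. V \<subseteq> insert x T"
  shows "linear_quotients (Ts @ Us)"
  using assms
proof (induction Ts)
  case (Cons T Ts)
  have "\<exists>x\<in>U - T. \<exists>V\<in>set Ts \<union> set Us. V \<subseteq> insert x T" if "U \<in> set Ts \<union> set Us" for U
  proof (cases "U \<in> set Us")
    case True
    then obtain x V where "x \<in> U - T" "V \<in> set Us" "V \<subseteq> insert x T"
      using Cons.prems(3)[of T U] by auto
    then show ?thesis by blast
  next
    case False
    then have "U \<in> set Ts" using that by simp
    then obtain x V where "x \<in> U - T" "V \<in> set Ts" "V \<subseteq> insert x T"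
      using Cons.prems(1) unfolding linear_quotients.simps by blast
    then show ?thesis by blast
  qed
  moreover have "linear_quotients (Ts @ Us)"
  proof (rule Cons.IH)
    show "linear_quotients Ts" using Cons.prems(1) by simp
    show "linear_quotients Us" by (rule Cons.prems(2))
    show "\<exists>x\<in>U - T'. \<exists>V\<in>set Us. V \<subseteq> insert x T'" if "T' \<in> set Ts" "U \<in> set Us" for T' U
      using Cons.prems(3)[of T' U] that by simp
  qed
  ultimately show ?case by simp
qed simp

lemma linear_quotients_appendD:
  "linear_quotients (Ts @ Us) \<Longrightarrow> linear_quotients Us"
  by (induction Ts) auto

text \<open>This is the classical passage from decomposability to shellability: the facets of the
  deletion come first, then those containing the shedding face.\<close>

lemma nonface_decomposable_linear_quotients:
  assumes "nonface_decomposable k N"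
  shows "\<exists>Ts. set Ts = N \<and> linear_quotients Ts"
  using assms
proof (induction rule: nonface_decomposable.induct)
  case (single T)
  show ?case by (rule exI[of _ "[T]"]) simp
next
  case (shed \<sigma> N)
  obtain Ts where Ts: "set Ts = {T \<in> N. T \<inter> \<sigma> = {}}" "linear_quotients Ts" using shed by blast
  obtain Us where Us: "set Us = {T \<in> N. T \<inter> \<sigma> \<noteq> {}}" "linear_quotients Us" using shed by blast
  have "linear_quotients (Ts @ Us)"
  proof (rule linear_quotients_append[OF Ts(2) Us(2)])
    fix T U assume TU: "T \<in> set Ts" "U \<in> set Us"
    then obtain x where x: "x \<in> U" "x \<in> \<sigma>" using Us by auto
    \<comment> \<open>Containing \<open>x\<close>, the set \<open>V\<close> meets
      \<open>\<sigma>\<close> and so is older; \<open>x\<close> is outside \<open>T\<close> because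
      \<open>T\<close> avoids \<open>\<sigma>\<close>.\<close>
    then obtain V where "V \<in> N" "x \<in> V" "V \<subseteq> insert x T" using shed.hyps(4)[of T x] TU Ts by auto
    then show "\<exists>x\<in>U - T. \<exists>V\<in>set Us. V \<subseteq> insert x T"
      using x TU Ts Us by (intro bexI[of _ x] bexI[of _ V]) auto
  qed
  moreover have "set (Ts @ Us) = N" using Ts Us by auto
  ultimately show ?case by blast
qed

text \<open>The shedding face of each step is the restriction of the last facet of the shelling.\<close>
lemma linear_quotients_nonface_decomposable:
  assumes "linear_quotients Ts" "Ts \<noteq> []" "finite W"
    "\<And>T. T \<in> set Ts \<Longrightarrow> T \<subseteq> W \<and> card W \<le> card T + (k + 1)"
  shows "nonface_decomposable k (set Ts)"
  using assms
proof (induction Ts)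
  case (Cons T Ts)
  show ?case
  proof (cases "Ts = []")
    case True
    then show ?thesis by (simp add: nonface_decomposable.single)
  next
    case False
    have lq: "linear_quotients Ts" "\<And>U. U \<in> set Ts \<Longrightarrow> \<exists>x\<in>U - T. \<exists>V\<in>set Ts. V \<subseteq> insert x T"
      using Cons.prems(1) by simp_all
    have IH: "nonface_decomposable k (set Ts)"
    proof (rule Cons.IH[OF lq(1) False Cons.prems(3)])
      show "U \<subseteq> W \<and> card W \<le> card U + (k + 1)" if "U \<in> set Ts" for U
        by (rule Cons.prems(4)) (simp add: that)
    qed
    \<comment> \<open>\<open>R\<close> consists of the vertices whose removal from the facet
      \<open>W - T\<close> leaves a face of an older facet.\<close>
    define R where "R = {x. x \<notin> T \<and> (\<exists>U\<in>set Ts. U \<subseteq> insert x T)}"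
    \<comment> \<open>Since every older set meets \<open>R\<close>, shedding \<open>R\<close> splits
      off exactly \<open>T\<close>.\<close>
    have hit: "U \<inter> R \<noteq> {}" if "U \<in> set Ts" for U using lq(2)[OF that] by (auto simp: R_def)
    have ex: "\<exists>U\<in>set Ts. x \<in> U \<and> U \<subseteq> insert x T" if x: "x \<in> R" for x
    proof -
      obtain U where U: "U \<in> set Ts" "U \<subseteq> insert x T" using x unfolding R_def by blast
      \<comment> \<open>No older set lies inside \<open>T\<close>, so \<open>U\<close> must use the
        one extra point that it is allowed.\<close>
      obtain y where "y \<in> U - T" using lq(2)[OF U(1)] by auto
      then have "x \<in> U" using U(2) by auto
      then show ?thesis using U by auto
    qed
    have RW: "R \<subseteq> W - T"
    proof
      fix x assume x: "x \<in> R"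
      then obtain U where "U \<in> set Ts" "x \<in> U" using ex by blast
      moreover have "U \<subseteq> W" using Cons.prems(4)[of U] \<open>U \<in> set Ts\<close> by simp
      ultimately show "x \<in> W - T" using x by (auto simp: R_def)
    qed
    have TW: "T \<subseteq> W" "card W \<le> card T + (k + 1)" using Cons.prems(4)[of T] by simp_all
    have "card R \<le> card (W - T)" using RW Cons.prems(3) by (intro card_mono) auto
    also have "\<dots> \<le> k + 1" using TW Cons.prems(3) by (simp add: card_Diff_subset finite_subset[OF TW(1)])
    finally have cR: "card R \<le> k + 1" .
    have "last Ts \<in> set Ts" using False by simp
    then have "R \<noteq> {}" using hit by blast
    moreover have "finite R" using RW Cons.prems(3) by (auto intro: finite_subset)
    moreover have "{U \<in> set (T # Ts). U \<inter> R = {}} = {T}" using hit by (auto simp: R_def)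
    moreover have "{U \<in> set (T # Ts). U \<inter> R \<noteq> {}} = set Ts" using hit by (auto simp: R_def)
    moreover have "\<exists>V\<in>set (T # Ts). s \<in> V \<and> V \<subseteq> insert s U"
      if "U \<in> set (T # Ts)" "U \<inter> R = {}" "s \<in> R" for U s
    proof -
      have "U = T" using that(1,2) hit by auto
      then show ?thesis using ex[OF that(3)] by auto
    qed
    ultimately show ?thesis
      using cR IH nonface_decomposable.shed[of R k "set (T # Ts)"] nonface_decomposable.single[of k T]
      by presburger
  qed
qed simp

text \<open>Complemented, linear quotients say that whatever the new facet \<open>W - T\<close>
  shares with an older one lies in a ridge \<open>W - T - {x}\<close> which is itself shared with an
  older facet.\<close>

lemma shellable_dual_complex:
  assumes "linear_quotients Ts" "Ts \<noteq> []" "finite W" "\<And>T. T \<in> set Ts \<Longrightarrow> T \<subseteq> W \<and> card T = c"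
  shows "shellable (dual_complex W (set Ts))"
proof -
  \<comment> \<open>The reversal is needed because \<open>Ts\<close> has its newest set first,
    whereas a shelling begins with its oldest facet.\<close>
  define Fs where "Fs = map (\<lambda>T. W - T) (rev Ts)"
  let ?d = "int (card W - c) - 1"
  have "inj_on (\<lambda>T. W - T) (set Ts)"
  proof (rule inj_onI)
    fix T U assume "T \<in> set Ts" "U \<in> set Ts" "W - T = W - U"
    then show "T = U" using assms(4)[of T] assms(4)[of U] by blast
  qed
  then have dist: "distinct Fs"
    using linear_quotients_distinct[OF assms(1)] by (simp add: Fs_def distinct_map)
  have fac: "set Fs = facets (dual_complex W (set Ts))"
    unfolding dual_complex_def
    by (subst facets_generated[OF uniform_complements[OF assms(3,4)]]) (simp_all add: Fs_def)
  have "pure_complex (?d - 1) ((\<Union>i<j. Pow (Fs ! i)) \<inter> Pow (Fs ! j))" (is "pure_complex _ ?K")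
    if j: "0 < j" "j < length Fs" for j
  proof -
    define T where "T = rev Ts ! j"
    define Us where "Us = rev (take j (rev Ts))"
    have jl: "j < length (rev Ts)" using j by (simp add: Fs_def)
    have "rev Ts = rev Us @ T # drop (Suc j) (rev Ts)"
      using id_take_nth_drop[OF jl] by (simp add: T_def Us_def)
    then have "rev (rev Ts) = rev (rev Us @ T # drop (Suc j) (rev Ts))" by (rule arg_cong)
    then have spl: "Ts = rev (drop (Suc j) (rev Ts)) @ T # Us" by simp
    then have lq: "linear_quotients (T # Us)" using assms(1) linear_quotients_appendD by metis
    have "set Ts = set (rev (drop (Suc j) (rev Ts))) \<union> insert T (set Us)"
      by (subst spl) simp
    then have mem: "T \<in> set Ts" "set Us \<subseteq> set Ts" by auto
    have "T \<subseteq> W" "card T = c" using assms(4)[OF mem(1)] by auto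
    then have cWT: "card (W - T) = card W - c" using assms(3) by (simp add: card_Diff_subset finite_subset[OF \<open>T \<subseteq> W\<close>])
    have "(\<Union>i<j. Pow (Fs ! i)) = (\<Union>U\<in>set Us. Pow (W - U))"
    proof -
      have "set Us = (\<lambda>i. rev Ts ! i) ` {..<j}"
        using nth_image[of j "rev Ts"] jl by (simp add: Us_def lessThan_atLeast0)
      then show ?thesis using jl by (simp add: Fs_def)
    qed
    moreover have "Fs ! j = W - T" using jl by (simp add: Fs_def T_def)
    ultimately have K: "?K = (\<Union>U\<in>set Us. Pow (W - U)) \<inter> Pow (W - T)" by simp
    \<comment> \<open>\<open>X\<close> indexes the ridges of \<open>W - T\<close> that lie in older
      facets.\<close>
    define X where "X = {x \<in> W - T. \<exists>U\<in>set Us. U \<subseteq> insert x T}"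
    have "?K = generated ((\<lambda>x. W - T - {x}) ` X)"
    proof (intro equalityI subsetI)
      fix \<tau> assume "\<tau> \<in> ?K"
      then obtain U where U: "U \<in> set Us" "\<tau> \<subseteq> W - U" "\<tau> \<subseteq> W - T" unfolding K by auto
      then obtain x V where "x \<in> U - T" "V \<in> set Us" "V \<subseteq> insert x T" using lq by auto
      then have "x \<in> X" "\<tau> \<subseteq> W - T - {x}" using U mem(2) assms(4)[of U] by (auto simp: X_def)
      then show "\<tau> \<in> generated ((\<lambda>x. W - T - {x}) ` X)" by (auto simp: mem_generated)
    next
      fix \<tau> assume "\<tau> \<in> generated ((\<lambda>x. W - T - {x}) ` X)"
      then obtain x U where "U \<in> set Us" "U \<subseteq> insert x T" "\<tau> \<subseteq> W - T - {x}"
        by (auto simp: mem_generated X_def)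
      then have "\<tau> \<subseteq> W - U" "\<tau> \<subseteq> W - T" by auto
      then show "\<tau> \<in> ?K" unfolding K using \<open>U \<in> set Us\<close> by auto
    qed
    moreover have "uniform (card W - c - 1) ((\<lambda>x. W - T - {x}) ` X)"
    proof -
      have "finite X" "X \<subseteq> W - T" using assms(3) by (auto simp: X_def)
      then show ?thesis using assms(3) cWT by (auto simp: uniform_def)
    qed
    moreover have "X \<noteq> {}"
    proof -
      obtain U where "U \<in> set Us" using j jl by (cases Us) (auto simp: Us_def)
      then obtain x V where "x \<in> U - T" "V \<in> set Us" "V \<subseteq> insert x T" using lq by auto
      then show ?thesis using mem(2) assms(4)[of U] \<open>U \<in> set Us\<close> by (auto simp: X_def)
    qed
    \<comment> \<open>Subtraction of naturals truncates; a point of \<open>X\<close> shows that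
      \<open>card W - c\<close> is positive.\<close>
    moreover have "int (card W - c - 1) - 1 = ?d - 1"
    proof -
      have "W - T \<noteq> {}" using \<open>X \<noteq> {}\<close> by (auto simp: X_def)
      then have "card (W - T) > 0" using assms(3) by (simp add: card_gt_0_iff)
      then show ?thesis using cWT by simp
    qed
    ultimately show ?thesis
      using pure_complex_generated[of "card W - c - 1" "(\<lambda>x. W - T - {x}) ` X"] by simp
  qed
  moreover have "pure_complex ?d (dual_complex W (set Ts))"
    using assms by (intro pure_dual_complex) auto
  ultimately show ?thesis using dist fac unfolding shellable_def by blast
qed

section \<open>Constructible 2-complexes\<close>

text \<open>A simplex has a single facet, so the base case applies in every dimension.\<close>

lemma constructible_Pow:
  assumes "finite F"
  shows "constructible (int (card F) - 1) (Pow F)"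
proof -
  have u: "uniform (card F) {F}" using assms by (simp add: uniform_def)
  have g: "generated {F} = Pow F" by (simp add: generated_def)
  have "pure_complex (int (card F) - 1) (Pow F)" using pure_complex_generated[OF u] g by simp
  moreover have "facets (Pow F) = {F}" using facets_generated[OF u] g by simp
  ultimately show ?thesis by (intro constructible.base) simp_all
qed

text \<open>The edges share only the vertex \<open>b\<close>. Such a path is the intersection that
  occurs when a triangle is glued along two edges.\<close>

lemma constructible_two_edges:
  assumes "distinct [a, b, c]"
  shows "constructible 1 (Pow {a, b} \<union> Pow {b, c})"
proof (rule constructible.union)
  have u: "uniform 2 {{a, b}, {b, c}}" using assms by (simp add: uniform_def)
  have "generated {{a, b}, {b, c}} = Pow {a, b} \<union> Pow {b, c}" by (simp add: generated_def)
  then show "pure_complex 1 (Pow {a, b} \<union> Pow {b, c})" using pure_complex_generated[OF u] by simp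
  have "Pow {a, b} \<inter> Pow {b, c} = Pow {b}" using assms by auto
  then show "constructible (1 - 1) (Pow {a, b} \<inter> Pow {b, c})" using constructible_Pow[of "{b}"] by simp
  show "constructible 1 (Pow {a, b})" using constructible_Pow[of "{a, b}"] assms by simp
  show "constructible 1 (Pow {b, c})" using constructible_Pow[of "{b, c}"] assms by simp
qed

fun triangle :: "'a \<times> 'a \<times> 'a \<Rightarrow> 'a set" where
  "triangle (a, b, c) = {a, b, c}"

text \<open>The newest triangle is the head of the list. It is glued along its edge ab, or along its
  two edges ab and bc.\<close>
fun glued_triangles :: "('a \<times> 'a \<times> 'a) list \<Rightarrow> bool" where
  "glued_triangles [] \<longleftrightarrow> False"
| "glued_triangles [(a, b, c)] \<longleftrightarrow> distinct [a, b, c]"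
| "glued_triangles ((a, b, c) # t # ts) \<longleftrightarrow> glued_triangles (t # ts) \<and> distinct [a, b, c] \<and>
     (\<exists>u\<in>set (t # ts). {a, b} \<subseteq> triangle u) \<and>
     ((\<forall>u\<in>set (t # ts). c \<notin> triangle u) \<or>
      (\<exists>u\<in>set (t # ts). {b, c} \<subseteq> triangle u) \<and> (\<forall>u\<in>set (t # ts). \<not> {a, c} \<subseteq> triangle u))"

lemma uniform_glued_triangles: "glued_triangles ts \<Longrightarrow> uniform 3 (triangle ` set ts)"
  by (induction ts rule: glued_triangles.induct) (auto simp: uniform_def)

text \<open>Each new triangle meets the older ones in an edge or in a path of two edges, and both
  are constructible of dimension 1.\<close>

lemma constructible_glued_triangles:
  "glued_triangles ts \<Longrightarrow> constructible 2 (generated (triangle ` set ts))"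
proof (induction ts rule: glued_triangles.induct)
  case (2 a b c)
  then show ?case using constructible_Pow[of "{a, b, c}"] by (simp add: generated_def)
next
  case (3 a b c t ts)
  define K where "K = generated (triangle ` set (t # ts))"
  have gen: "generated (triangle ` set ((a, b, c) # t # ts)) = K \<union> Pow {a, b, c}"
    unfolding K_def list.set(2)[of "(a, b, c)"] image_insert generated_insert by simp
  have mem: "\<tau> \<in> K \<longleftrightarrow> (\<exists>u\<in>set (t # ts). \<tau> \<subseteq> triangle u)" for \<tau>
    unfolding K_def mem_generated by (rule bex_simps)
  note prems = 3(2)[unfolded glued_triangles.simps(3)]
  have dist: "distinct [a, b, c]" using prems by (elim conjE)
  have ts: "glued_triangles (t # ts)" using prems by (elim conjE)
  have ab: "{a, b} \<in> K" unfolding mem using prems by (elim conjE)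
  have alt: "(\<forall>u\<in>set (t # ts). c \<notin> triangle u) \<or> {b, c} \<in> K \<and> {a, c} \<notin> K"
    unfolding mem bex_simps(8) using prems by (elim conjE)
  have K: "constructible 2 K" unfolding K_def by (rule 3(1)[OF ts])
  have down: "\<tau> \<in> K" if "\<sigma> \<in> K" "\<tau> \<subseteq> \<sigma>" for \<sigma> \<tau>
    using that unfolding mem by (meson subset_trans)
  have "constructible 1 (K \<inter> Pow {a, b, c})"
    using alt
  proof
    assume "\<forall>u\<in>set (t # ts). c \<notin> triangle u"
    then have c: "c \<notin> \<sigma>" if "\<sigma> \<in> K" for \<sigma>
      using that unfolding mem by (meson subsetD)
    have "K \<inter> Pow {a, b, c} = Pow {a, b}"
    proof (intro equalityI subsetI)
      fix \<sigma> assume "\<sigma> \<in> Pow {a, b}"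
      then show "\<sigma> \<in> K \<inter> Pow {a, b, c}" using down[OF ab, of \<sigma>] by blast
    qed (use c in blast)
    then show ?thesis using constructible_Pow[of "{a, b}"] dist by simp
  next
    assume bc: "{b, c} \<in> K \<and> {a, c} \<notin> K"
    \<comment> \<open>A shared face cannot contain both \<open>a\<close> and \<open>c\<close>, so it
      lies in one of the two remaining edges.\<close>
    have "K \<inter> Pow {a, b, c} = Pow {a, b} \<union> Pow {b, c}"
    proof (intro equalityI subsetI)
      fix \<sigma> assume s: "\<sigma> \<in> K \<inter> Pow {a, b, c}"
      then have "\<not> {a, c} \<subseteq> \<sigma>" using down[of \<sigma> "{a, c}"] bc by blast
      then show "\<sigma> \<in> Pow {a, b} \<union> Pow {b, c}" using s by blast
    next
      fix \<sigma> assume "\<sigma> \<in> Pow {a, b} \<union> Pow {b, c}"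
      then show "\<sigma> \<in> K \<inter> Pow {a, b, c}"
        using down[OF ab, of \<sigma>] down[of "{b, c}" \<sigma>] bc by blast
    qed
    then show ?thesis using constructible_two_edges[OF dist] by simp
  qed
  moreover have "constructible 2 (Pow {a, b, c})"
    using constructible_Pow[of "{a, b, c}"] dist by simp
  moreover have "pure_complex 2 (K \<union> Pow {a, b, c})"
    using pure_complex_generated[OF uniform_glued_triangles[OF 3(2)]] unfolding gen by simp
  ultimately show ?case unfolding gen using K by (intro constructible.union) simp_all
qed simp

text \<open>The gluing conditions also forbid incidences, so they have to be transported as
  equivalences, which injectivity provides.\<close>

lemma glued_triangles_map:
  assumes "inj f"
  shows "glued_triangles ts \<Longrightarrow> glued_triangles (map (\<lambda>(a, b, c). (f a, f b, f c)) ts)"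
proof (induction ts rule: glued_triangles.induct)
  case (2 a b c)
  then show ?case using assms by (simp add: inj_eq)
next
  case (3 a b c t ts)
  define g where "g = (\<lambda>(a, b, c). (f a, f b, f c))"
  have tri: "triangle (g u) = f ` triangle u" for u
    by (cases u) (simp add: g_def)
  have mem: "f x \<in> triangle (g u) \<longleftrightarrow> x \<in> triangle u" for x u
    unfolding tri by (rule inj_image_mem_iff[OF assms])
  have ex: "(\<exists>u\<in>g ` A. {f x, f y} \<subseteq> triangle u) \<longleftrightarrow> (\<exists>u\<in>A. {x, y} \<subseteq> triangle u)" for A x y
    by (simp add: mem)
  have all: "(\<forall>u\<in>g ` A. \<not> {f x, f y} \<subseteq> triangle u) \<longleftrightarrow> (\<forall>u\<in>A. \<not> {x, y} \<subseteq> triangle u)" for A x y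
    by (simp add: mem)
  have all': "(\<forall>u\<in>g ` A. f x \<notin> triangle u) \<longleftrightarrow> (\<forall>u\<in>A. x \<notin> triangle u)" for A x
    by (simp add: mem)
  have set: "set (g t # map g ts) = g ` set (t # ts)" by simp
  have dist: "distinct [f a, f b, f c] \<longleftrightarrow> distinct [a, b, c]" by (simp add: inj_eq[OF assms])
  note prems = 3(2)[unfolded glued_triangles.simps(3)]
  have "glued_triangles (map g (t # ts))" unfolding g_def using prems by (intro 3(1)) (elim conjE)
  then have "glued_triangles (g t # map g ts)" by simp
  then have "glued_triangles ((f a, f b, f c) # g t # map g ts)"
    unfolding glued_triangles.simps(3) set ex all all' dist using prems by blast
  then show ?case by (simp add: g_def)
qed simp

lemma linear_quotients_map:
  assumes "inj f"
  shows "linear_quotients Ts \<Longrightarrow> linear_quotients (map ((`) f) Ts)"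
proof (induction Ts)
  case (Cons T Ts)
  have "\<exists>x\<in>f ` U - f ` T. \<exists>V\<in>set (map ((`) f) Ts). V \<subseteq> insert x (f ` T)" if U: "U \<in> set Ts" for U
  proof -
    obtain x V where "x \<in> U - T" "V \<in> set Ts" "V \<subseteq> insert x T" using Cons.prems U by auto
    then show ?thesis
      by (intro bexI[of _ "f x"] bexI[of _ "f ` V"]) (auto simp: inj_image_mem_iff[OF assms])
  qed
  then show ?case using Cons by simp
qed simp

section \<open>Families of triples that meet a set\<close>

text \<open>The complements are ridges of the simplex on \<open>W - S\<close>. Every member contains
  \<open>S\<close>, so the exchange for \<open>insert x S\<close> is always available and the
  vertices shed one by one.\<close>

lemma nonface_decomposable_star:
  assumes "finite X" "X \<noteq> {}" "X \<inter> S = {}"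
  shows "nonface_decomposable k ((\<lambda>x. insert x S) ` X)"
  using assms
proof (induction X rule: finite_ne_induct)
  case (singleton x)
  then show ?case by (simp add: nonface_decomposable.single)
next
  case (insert x X)
  let ?N = "(\<lambda>y. insert y S) ` insert x X"
  have "{T \<in> ?N. T \<inter> {x} = {}} = (\<lambda>y. insert y S) ` X" using insert.hyps insert.prems by auto
  moreover have "{T \<in> ?N. T \<inter> {x} \<noteq> {}} = {insert x S}" using insert.hyps insert.prems by auto
  moreover have "nonface_decomposable k ((\<lambda>y. insert y S) ` X)" using insert.IH insert.prems by blast
  moreover have "\<exists>T'\<in>?N. s \<in> T' \<and> T' \<subseteq> insert s T" if "T \<in> ?N" "s \<in> {x}" for T s
    using that by (intro bexI[of _ "insert x S"]) auto
  ultimately show ?case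
    by (rule_tac nonface_decomposable.shed[of "{x}"]) (simp_all add: nonface_decomposable.single)
qed

lemma card_2_containing:
  "{p. p \<subseteq> W \<and> card p = 2 \<and> t \<in> p} = (\<lambda>x. {x, t}) ` (W - {t})" if "t \<in> W"
  using that by (auto simp: card_2_iff image_iff)

lemma nonface_decomposable_pairs:
  assumes "finite A" "A \<noteq> {}" "A \<subseteq> W" "finite W" "card W \<ge> 2" "v \<notin> W"
  shows "nonface_decomposable k (insert v ` {p. p \<subseteq> W \<and> card p = 2 \<and> p \<inter> A \<noteq> {}})"
  using assms
proof (induction A arbitrary: W rule: finite_ne_induct)
  case (singleton t)
  have "insert v ` {p. p \<subseteq> W \<and> card p = 2 \<and> p \<inter> {t} \<noteq> {}} = (\<lambda>x. insert x {v, t}) ` (W - {t})"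
    using card_2_containing[of t W] singleton.prems(1)
    by (simp add: image_image insert_commute)
  moreover have "W - {t} \<noteq> {}"
  proof
    assume "W - {t} = {}"
    moreover have "card (W - {t}) \<ge> 1" using singleton.prems by simp
    ultimately show False by (metis card.empty not_one_le_zero)
  qed
  ultimately show ?case
    using nonface_decomposable_star[of "W - {t}" "{v, t}" k] singleton.prems by auto
next
  case (insert t A)
  let ?P = "\<lambda>A W. insert v ` {p. p \<subseteq> W \<and> card p = 2 \<and> p \<inter> A \<noteq> {}}"
  have tv: "t \<noteq> v" "t \<in> W" using insert.prems by auto
  show ?case
  \<comment> \<open>With two points there is only one pair. Treating this case apart keeps
    \<open>W - {t}\<close> large enough for the induction hypothesis.\<close>
  proof (cases "card W = 2")
    case True
    have "p = W" if "p \<subseteq> W" "card p = 2" for p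
      using that True insert.prems(2) by (simp add: card_subset_eq)
    then have "{p. p \<subseteq> W \<and> card p = 2 \<and> p \<inter> insert t A \<noteq> {}} = {W}"
      using True tv by auto
    then show ?thesis by (simp add: nonface_decomposable.single)
  next
    case False
    let ?N = "?P (insert t A) W"
    have L: "{T \<in> ?N. T \<inter> {t} = {}} = ?P A (W - {t})" using tv by auto
    have M: "{T \<in> ?N. T \<inter> {t} \<noteq> {}} = (\<lambda>x. insert x {v, t}) ` (W - {t})"
    proof -
      have "{T \<in> ?N. T \<inter> {t} \<noteq> {}} = insert v ` {p. p \<subseteq> W \<and> card p = 2 \<and> t \<in> p}"
        using tv by auto
      also have "\<dots> = (\<lambda>x. insert x {v, t}) ` (W - {t})"
        unfolding card_2_containing[OF tv(2)] by (simp add: image_image insert_commute)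
      finally show ?thesis .
    qed
    have cW: "card (W - {t}) \<ge> 2" using False tv insert.prems by simp
    show ?thesis
    proof (rule nonface_decomposable.shed[of "{t}"])
      have "nonface_decomposable k (?P A (W - {t}))"
        using insert.hyps insert.prems cW by (intro insert.IH) auto
      then show "nonface_decomposable k {T \<in> ?N. T \<inter> {t} = {}}" unfolding L .
      have "W - {t} \<noteq> {}" using cW by (metis card.empty not_numeral_le_zero)
      then show "nonface_decomposable k {T \<in> ?N. T \<inter> {t} \<noteq> {}}"
        unfolding M using insert.prems by (intro nonface_decomposable_star) auto
    next
      fix T s assume T: "T \<in> ?N" "T \<inter> {t} = {}" "s \<in> {t}"
      then obtain p where p: "T = insert v p" "p \<subseteq> W" "p \<inter> A \<noteq> {}" by auto
      then obtain x where x: "x \<in> p" "x \<in> A" by auto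
      then have "x \<noteq> t" using T(2) p(1) by auto
      then have "insert v {x, t} \<in> ?N" using x p tv by (intro imageI) auto
      then show "\<exists>T'\<in>?N. s \<in> T' \<and> T' \<subseteq> insert s T" using x p T by (intro bexI[of _ "insert v {x, t}"]) auto
    qed simp_all
  qed
qed

text \<open>Intended for \<open>U\<close> the vertices of the last copy, \<open>A\<close> its
  private ones, \<open>C\<close> its triangles and \<open>V\<close> the vertices outside it. No
  member of \<open>C\<close> contains a point \<open>v\<close> of \<open>V\<close>, so the triples
  through \<open>v\<close> are given by all pairs meeting \<open>A\<close>, and shedding
  \<open>v\<close> reduces \<open>V\<close>.\<close>

lemma nonface_decomposable_mixed:
  fixes C :: "'a set set"
  defines "F \<equiv> \<lambda>A U V. {T. T \<subseteq> U \<union> V \<and> card T = 3 \<and> T \<inter> A \<noteq> {} \<and> T \<notin> C}"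
  assumes "finite V" "V \<inter> U = {}" "finite U" "A \<subseteq> U" "A \<noteq> {}" "card U \<ge> 2" "\<And>T. T \<in> C \<Longrightarrow> T \<subseteq> U"
    and "nonface_decomposable k (F A U {})"
  shows "nonface_decomposable k (F A U V)"
  using assms(2,3)
proof (induction V rule: finite_induct)
  case empty
  show ?case by (rule assms(9))
next
  case (insert v V)
  have v: "v \<notin> U" "v \<notin> V" using insert by auto
  have fin: "finite (U \<union> V)" using insert.hyps assms(4) by simp
  let ?N = "F A U (insert v V)"
  have L: "{T \<in> ?N. T \<inter> {v} = {}} = F A U V" unfolding F_def using v by auto
  have M: "{T \<in> ?N. T \<inter> {v} \<noteq> {}} = insert v ` {p. p \<subseteq> U \<union> V \<and> card p = 2 \<and> p \<inter> A \<noteq> {}}"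
  proof (intro equalityI subsetI)
    fix T assume T: "T \<in> {T \<in> ?N. T \<inter> {v} \<noteq> {}}"
    have "v \<in> T" "T \<subseteq> U \<union> insert v V" "card T = 3" "T \<inter> A \<noteq> {}" using T by (auto simp: F_def)
    moreover from this have "card (T - {v}) = 2" by simp
    moreover have "(T - {v}) \<inter> A \<noteq> {}" using calculation(4) assms(5) v by auto
    ultimately show "T \<in> insert v ` {p. p \<subseteq> U \<union> V \<and> card p = 2 \<and> p \<inter> A \<noteq> {}}"
      by (intro image_eqI[of _ _ "T - {v}"]) auto
  next
    fix T assume "T \<in> insert v ` {p. p \<subseteq> U \<union> V \<and> card p = 2 \<and> p \<inter> A \<noteq> {}}"
    then obtain p where p: "T = insert v p" "p \<subseteq> U \<union> V" "card p = 2" "p \<inter> A \<noteq> {}" by auto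
    have "finite p" using p(2) fin by (rule finite_subset)
    moreover have "v \<notin> p" using p(2) v by auto
    ultimately have "card T = 3" using p by simp
    moreover have "T \<notin> C" using assms(8)[of T] p(1) v by auto
    ultimately show "T \<in> {T \<in> ?N. T \<inter> {v} \<noteq> {}}" using p by (auto simp: F_def)
  qed
  have cUV: "card (U \<union> V) \<ge> 2" using card_mono[of "U \<union> V" U] fin assms(7) by auto
  show ?case
  proof (rule nonface_decomposable.shed[of "{v}"])
    show "nonface_decomposable k {T \<in> ?N. T \<inter> {v} = {}}"
      unfolding L using insert.IH insert.prems by auto
    show "nonface_decomposable k {T \<in> ?N. T \<inter> {v} \<noteq> {}}"
      unfolding M
    proof (rule nonface_decomposable_pairs[OF _ assms(6) _ fin cUV])
      show "finite A" using assms(5,4) by (rule finite_subset)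
      show "A \<subseteq> U \<union> V" "v \<notin> U \<union> V" using assms(5) v by auto
    qed
  next
    fix T s assume T: "T \<in> ?N" "T \<inter> {v} = {}" "s \<in> {v}"
    \<comment> \<open>The replacement keeps a point \<open>t\<close> of \<open>A\<close> and one
      other point of \<open>T\<close>; containing \<open>v\<close>, it cannot belong to
      \<open>C\<close>.\<close>
    obtain t where t: "t \<in> T" "t \<in> A" using T(1) by (auto simp: F_def)
    have "T \<noteq> {t}" using T(1) by (auto simp: F_def)
    then obtain x where x: "x \<in> T" "x \<noteq> t" using t by auto
    have "v \<noteq> t" "v \<noteq> x" using T(2) t x by auto
    then have "card {v, t, x} = 3" using x by simp
    moreover have "{v, t, x} \<notin> C" using assms(8)[of "{v, t, x}"] v by auto
    ultimately have "{v, t, x} \<in> ?N" using T(1) t x by (auto simp: F_def)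
    then show "\<exists>T'\<in>?N. s \<in> T' \<and> T' \<subseteq> insert s T" using t x T(3) by (intro bexI[of _ "{v, t, x}"]) auto
  qed simp_all
qed

section \<open>The block\<close>

text \<open>Both lists were found by computer search.\<close>
definition block :: "(nat \<times> nat \<times> nat) list" where
  "block =
    [(1,3,2), (1,4,3), (3,7,4), (3,5,7), (5,2,7),
     (2,6,7), (2,6,3), (5,6,3), (2,4,6), (4,7,6),
     (6,1,7), (1,5,6), (4,5,2), (1,4,7), (1,4,5)]"

definition block_nonfaces :: "nat set list" where
  "block_nonfaces =
    [{2,4,7}, {4,5,7}, {3,4,5}, {1,3,7}, {1,3,5},
     {1,5,7}, {5,6,7}, {1,3,6}, {3,6,7}, {1,2,6},
     {4,5,6}, {3,4,6}, {1,4,6}, {1,2,4}, {1,2,7},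
     {2,3,7}, {2,3,4}, {1,2,5}, {2,5,6}, {2,3,5}]"


text \<open>The order of the list and of the entries in each triple encodes the gluing, which
  evaluation verifies. The triangle glued last, \<open>(1,3,2)\<close>, is the only one containing
  the edge \<open>{1, 2}\<close>.\<close>

lemma glued_triangles_block: "glued_triangles block"
  unfolding block_def by code_simp

lemma linear_quotients_block_nonfaces: "linear_quotients block_nonfaces"
  unfolding block_nonfaces_def by code_simp

text \<open>The 15 triangles and 20 nonfaces exhaust the 35 triples of seven points. The quantifiers
  range over explicit lists so that evaluation can decide the statement.\<close>

lemma block_cover:
  "\<forall>x\<in>set [1, 2, 3, 4, 5, 6, 7]. \<forall>y\<in>set [1, 2, 3, 4, 5, 6, 7]. \<forall>z\<in>set [1, 2, 3, 4, 5, 6, 7].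
     x < y \<and> y < z \<longrightarrow> {x, y, z} \<in> set (map triangle block) \<or> {x, y, z} \<in> set block_nonfaces"
  unfolding block_def block_nonfaces_def by code_simp

lemma block_disjoint: "\<forall>T\<in>set (map triangle block). T \<notin> set block_nonfaces"
  unfolding block_def block_nonfaces_def by code_simp

text \<open>Here \<open>T'\<close> differs from \<open>T\<close>, since \<open>T\<close> contains no
  triple but itself. So every edge except \<open>{1, 2}\<close> lies in two triangles whose union is
  not a clique.\<close>

lemma block_ridges:
  "\<forall>T\<in>set (map triangle block). \<forall>x\<in>T. T - {x} = {1, 2} \<or>
     (\<exists>T'\<in>set (map triangle block). T - {x} \<subseteq> T' \<and> (\<exists>S\<in>set block_nonfaces. S \<subseteq> T \<union> T'))"
  unfolding block_def block_nonfaces_def by code_simp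

definition block_triangles :: "nat set set" where
  "block_triangles = set (map triangle block)"

lemma three_subset_block:
  assumes "T \<subseteq> {1..7::nat}" "card T = 3"
  shows "T \<in> block_triangles \<or> T \<in> set block_nonfaces"
proof -
  obtain x y z where T: "T = {x, y, z}" "x < y" "y < z"
  proof -
    define l where "l = sorted_list_of_set T"
    have "finite T" using assms(1) by (rule finite_subset) simp
    then have l: "set l = T" "sorted_wrt (<) l" "length l = 3"
      unfolding l_def using assms(2) by (simp_all only: set_sorted_list_of_set
        strict_sorted_list_of_set length_sorted_list_of_set)
    then obtain x y z where "l = [x, y, z]" by (auto simp: length_Suc_conv numeral_3_eq_3)
    then show ?thesis using l by (intro that[of x y z]) auto
  qed
  have "{1..7::nat} = set [1, 2, 3, 4, 5, 6, 7]" by auto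
  then have "x \<in> set [1, 2, 3, 4, 5, 6, 7]" "y \<in> set [1, 2, 3, 4, 5, 6, 7]" "z \<in> set [1, 2, 3, 4, 5, 6, 7]"
    using assms(1) T(1) by blast+
  then show ?thesis using block_cover T unfolding block_triangles_def by blast
qed

lemma block_subset: "T \<in> block_triangles \<union> set block_nonfaces \<Longrightarrow> T \<subseteq> {1..7} \<and> card T = 3"
  unfolding block_triangles_def block_def block_nonfaces_def by auto

lemma block_nonfaces_eq:
  "set block_nonfaces = {T. T \<subseteq> {1..7} \<and> card T = 3 \<and> T \<notin> block_triangles}"
  using three_subset_block block_subset block_disjoint unfolding block_triangles_def by blast

lemma block_vertices: "\<Union>block_triangles = {1..7}"
proof
  show "\<Union>block_triangles \<subseteq> {1..7}" using block_subset by blast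
  show "{1..7} \<subseteq> \<Union>block_triangles" unfolding block_triangles_def block_def by auto
qed

section \<open>Copies glued along the free edge\<close>

text \<open>The vertices 1 and 2 span the only free edge of the block and are shared by all copies.\<close>
definition place :: "nat \<Rightarrow> nat \<Rightarrow> nat" where
  "place i v = (if v \<le> 2 then v else 5 * i + v)"

abbreviation inner :: "nat \<Rightarrow> nat set" where
  "inner i \<equiv> {5 * i + 3..5 * i + 7}"

lemma inj_place: "inj (place i)"
  by (auto simp: inj_def place_def split: if_splits)

lemma card_place: "card (place i ` T) = card T"
  by (rule card_image) (rule inj_on_subset[OF inj_place subset_UNIV])

lemma place_image: "place i ` {1..7} = {1, 2} \<union> inner i"
proof
  show "place i ` {1..7} \<subseteq> {1, 2} \<union> inner i" by (auto simp: place_def)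
  show "{1, 2} \<union> inner i \<subseteq> place i ` {1..7}"
  proof
    fix x assume "x \<in> {1, 2} \<union> inner i"
    then have "x = place i (if x \<le> 2 then x else x - 5 * i)" "(if x \<le> 2 then x else x - 5 * i) \<in> {1..7}"
      by (auto simp: place_def)
    then show "x \<in> place i ` {1..7}" by (rule image_eqI)
  qed
qed

definition copy :: "nat \<Rightarrow> nat set set" where
  "copy i = (`) (place i) ` block_triangles"

definition glued_blocks :: "nat \<Rightarrow> nat set set" where
  "glued_blocks k = (\<Union>i<k. copy i)"

lemma copy_subset:
  assumes "T \<in> copy i"
  shows "T \<subseteq> {1, 2} \<union> inner i" "card T = 3"
proof -
  obtain S where S: "S \<in> block_triangles" "T = place i ` S" using assms by (auto simp: copy_def)
  then have "S \<subseteq> {1..7}" "card S = 3" using block_subset by auto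
  then show "T \<subseteq> {1, 2} \<union> inner i" "card T = 3"
    using S(2) place_image[of i] card_place[of i S] by auto
qed

lemma three_set_meets:
  assumes "card T = 3"
  obtains x where "x \<in> T" "x \<noteq> 1" "x \<noteq> (2::nat)"
proof -
  have "\<not> T \<subseteq> {1, 2}" using assms card_mono[of "{1, 2}" T] by auto
  then show ?thesis using that by auto
qed

text \<open>The ranges \<open>inner i\<close> are pairwise disjoint, so one private vertex
  determines the copy to which a triangle belongs.\<close>

lemma glued_blocks_inner:
  assumes "T \<in> glued_blocks k" "x \<in> T" "x \<in> inner i"
  shows "T \<in> copy i" "i < k"
proof -
  obtain j where j: "j < k" "T \<in> copy j" using assms(1) by (auto simp: glued_blocks_def)
  then have "x \<in> {1, 2} \<union> inner j" using assms(2) copy_subset by blast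
  then have "i = j" using assms(3) by auto
  then show "T \<in> copy i" "i < k" using j by auto
qed

lemma uniform_copy: "uniform 3 (copy i)"
proof -
  have "finite (copy i)" by (simp add: copy_def block_triangles_def)
  moreover have "finite T \<and> card T = 3" if "T \<in> copy i" for T
    using copy_subset[OF that] by (metis card.infinite zero_neq_numeral)
  ultimately show ?thesis by (simp add: uniform_def)
qed

lemma uniform_glued_blocks: "uniform 3 (glued_blocks k)"
  using uniform_copy by (auto simp: uniform_def glued_blocks_def)

lemma free_edge_copy: "{1, 2, 5 * i + 3} \<in> copy i"
proof -
  have "{1, 3, 2} \<in> block_triangles" by (simp add: block_triangles_def block_def)
  then have "place i ` {1, 3, 2} \<in> copy i" unfolding copy_def by (rule imageI)
  then show ?thesis by (simp add: place_def insert_commute)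
qed

lemma glued_blocks_Suc: "glued_blocks (Suc k) = glued_blocks k \<union> copy k"
  by (auto simp: glued_blocks_def lessThan_Suc)

lemma glued_blocks_1: "glued_blocks 1 = copy 0"
  by (simp add: glued_blocks_def lessThan_Suc)

lemma constructible_copy: "constructible 2 (generated (copy i))"
proof -
  define g where "g = (\<lambda>(a, b, c). (place i a, place i b, place i c))"
  have "triangle (g t) = place i ` triangle t" for t by (cases t) (simp add: g_def)
  then have "triangle ` set (map g block) = copy i"
    by (simp add: copy_def block_triangles_def image_image)
  moreover have "glued_triangles (map g block)"
    unfolding g_def by (rule glued_triangles_map[OF inj_place glued_triangles_block])
  ultimately show ?thesis using constructible_glued_triangles by metis
qed

lemma constructible_glued_blocks: "k \<ge> 1 \<Longrightarrow> constructible 2 (generated (glued_blocks k))"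
proof (induction k rule: dec_induct)
  case base
  show ?case using constructible_copy[of 0] unfolding glued_blocks_1 .
next
  case (step k)
  \<comment> \<open>A common vertex other than 1 and 2 would be private to copy \<open>k\<close>,
    hence in no earlier triangle. Conversely, copies 0 and \<open>k\<close> both contain the shared
    edge.\<close>
  have "generated (glued_blocks k) \<inter> generated (copy k) = Pow {1, 2}"
  proof (intro equalityI subsetI)
    fix \<sigma> assume "\<sigma> \<in> generated (glued_blocks k) \<inter> generated (copy k)"
    then obtain S T where ST: "S \<in> glued_blocks k" "\<sigma> \<subseteq> S" "T \<in> copy k" "\<sigma> \<subseteq> T"
      by (auto simp: mem_generated)
    have "x \<in> {1, 2}" if "x \<in> \<sigma>" for x
    proof (rule ccontr)
      assume "x \<notin> {1, 2}"
      then have "x \<in> inner k" using copy_subset(1)[OF ST(3)] ST(4) that by blast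
      then show False using glued_blocks_inner(2)[OF ST(1), of x k] ST(2) that by auto
    qed
    then show "\<sigma> \<in> Pow {1, 2}" by blast
  next
    fix \<sigma> :: "nat set" assume "\<sigma> \<in> Pow {1, 2}"
    then have "\<sigma> \<subseteq> {1, 2, 5 * i + 3}" for i by auto
    moreover have "{1, 2, 5 * 0 + 3} \<in> glued_blocks k"
      unfolding glued_blocks_def using step.hyps by (intro UN_I[of 0] free_edge_copy) auto
    ultimately show "\<sigma> \<in> generated (glued_blocks k) \<inter> generated (copy k)"
      unfolding mem_generated Int_iff using free_edge_copy[of k] by blast
  qed
  moreover have "constructible 1 (Pow {1::nat, 2})" using constructible_Pow[of "{1::nat, 2}"] by simp
  moreover have "pure_complex 2 (generated (glued_blocks (Suc k)))"
    using pure_complex_generated[OF uniform_glued_blocks[of "Suc k"]] free_edge_copy[of k]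
    by (auto simp: glued_blocks_Suc)
  ultimately show ?case
    using step.IH constructible_copy[of k] unfolding glued_blocks_Suc generated_Un
    by (intro constructible.union) simp_all
qed

lemma vertices_glued_blocks:
  assumes "k \<ge> 1"
  shows "\<Union>(glued_blocks k) = {1..5 * k + 2}"
proof
  show "\<Union>(glued_blocks k) \<subseteq> {1..5 * k + 2}"
  proof
    fix x assume "x \<in> \<Union>(glued_blocks k)"
    then obtain i T where i: "i < k" "T \<in> copy i" "x \<in> T" by (auto simp: glued_blocks_def)
    then have "x \<in> {1, 2} \<union> inner i" using copy_subset by blast
    then show "x \<in> {1..5 * k + 2}" using i(1) by auto
  qed
  have U: "\<Union>(copy i) = {1, 2} \<union> inner i" for i
    unfolding copy_def image_Union[symmetric] block_vertices place_image ..
  show "{1..5 * k + 2} \<subseteq> \<Union>(glued_blocks k)"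
  proof
    fix x assume x: "x \<in> {1..5 * k + 2}"
    have "\<exists>i<k. x \<in> {1, 2} \<union> inner i"
    proof (cases "x \<le> 2")
      case True
      then show ?thesis using x assms by (intro exI[of _ 0]) auto
    next
      case False
      \<comment> \<open>The private vertices of copy \<open>i\<close> start at
        \<open>5 * i + 3\<close> and are five in number.\<close>
      then show ?thesis using x by (intro exI[of _ "(x - 3) div 5"]) auto
    qed
    then show "x \<in> \<Union>(glued_blocks k)" unfolding U[symmetric] by (auto simp: glued_blocks_def)
  qed
qed

section \<open>Obstruction to ridge deletions\<close>

text \<open>Not even a first deletion is possible: the star of each edge contains a triple that is
  not a triangle of the complex.\<close>

lemma not_ridge_chordal_glued_blocks:
  assumes "k \<ge> 2"
  shows "\<not> ridge_chordal n 2 (generated (glued_blocks k))"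
proof
  define K where "K = generated (glued_blocks k)"
  have fac: "facets K = glued_blocks k" unfolding K_def by (rule facets_generated[OF uniform_glued_blocks])
  assume "ridge_chordal n 2 (generated (glued_blocks k))"
  then have "ridge_reducible n 2 K" by (simp add: ridge_chordal_def K_def)
  then show False
  proof cases
    case reduced
    have "{1, 2, 5 * 0 + 3} \<in> glued_blocks k"
      unfolding glued_blocks_def using assms by (intro UN_I[of 0] free_edge_copy) auto
    then have "{1, 2, 3} \<in> K" by (auto simp: K_def mem_generated)
    then show False using reduced[of "{1, 2, 3}"] by (simp add: dim_face_def)
  next
    case (delete_ridge r)
    have star: "F \<subseteq> vertices (star r K)" if "F \<in> glued_blocks k" "r \<subseteq> F" for F
    proof -
      have "F \<in> star r K" unfolding star_def fac using that by auto
      then show ?thesis by (auto simp: vertices_def)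
    qed
    have cl: "S \<in> glued_blocks k" if "S \<subseteq> vertices (star r K)" "card S = 3" for S
    proof -
      have "\<forall>\<tau>\<subseteq>vertices (star r K). int (card \<tau>) = 2 + 1 \<longrightarrow> \<tau> \<in> glued_blocks k"
        using delete_ridge(3) unfolding clique_def fac by (rule conjunct2)
      then show ?thesis using that by simp
    qed
    have "card r = 2" using delete_ridge(2) by (simp add: dim_face_def)
    obtain i T where T: "i < k" "T \<in> block_triangles" "r \<subseteq> place i ` T"
      using delete_ridge(1) by (auto simp: K_def mem_generated glued_blocks_def copy_def)
    have cT: "card T = 3" "T \<subseteq> {1..7}" using block_subset[of T] T(2) by simp_all
    then have finT: "finite T" by (metis card.infinite zero_neq_numeral)
    have "card (place i ` T) = 3" using cT by (simp add: card_place)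
    then have "r \<noteq> place i ` T" using \<open>card r = 2\<close> by auto
    then obtain x where x: "x \<in> T" "place i x \<notin> r" using T(3) by auto
    have "r = place i ` (T - {x})"
    proof (rule card_subset_eq)
      show "r \<subseteq> place i ` (T - {x})" using T(3) x(2) by auto
      have "card (T - {x}) = 2" using cT x(1) by simp
      then show "card r = card (place i ` (T - {x}))"
        using \<open>card r = 2\<close> by (simp only: card_place)
    qed (use finT in simp)
    have "T \<in> set (map triangle block)" using T(2) by (simp add: block_triangles_def)
    from block_ridges[rule_format, OF this x(1)] show False
    proof (elim disjE bexE conjE)
      assume "T - {x} = {1, 2}"
      then have r: "r = {1, 2}" using \<open>r = _\<close> by (simp add: place_def)
      \<comment> \<open>Here two copies are needed: the star of the shared edge contains 3 from copy
        0 and 8 from copy 1, and no triangle joins them.\<close>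
      have "{1, 2, 5 * j + 3} \<subseteq> vertices (star r K)" if "j < 2" for j
        by (rule star) (use that assms free_edge_copy[of j] in \<open>auto simp: glued_blocks_def r\<close>)
      from this[of 0] this[of 1] have "{1, 3, 8} \<in> glued_blocks k" by (intro cl) auto
      from glued_blocks_inner(1)[OF this, of 3 0] have "{1, 3, 8} \<in> copy 0" by simp
      from copy_subset(1)[OF this] show False by auto
    next
      fix T' S
      assume T': "T' \<in> set (map triangle block)" "T - {x} \<subseteq> T'" and S: "S \<in> set block_nonfaces" "S \<subseteq> T \<union> T'"
      have T'b: "T' \<in> block_triangles" using T' by (simp add: block_triangles_def)
      have nk: "place i ` U \<in> glued_blocks k" if "U \<in> block_triangles" for U
        using that T(1) by (auto simp: glued_blocks_def copy_def)
      have "place i ` T \<subseteq> vertices (star r K)" using nk[OF T(2)] T(3) by (rule star)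
      moreover have "place i ` T' \<subseteq> vertices (star r K)"
        using nk[OF T'b] by (rule star) (use T'(2) \<open>r = _\<close> in blast)
      ultimately have sub: "place i ` S \<subseteq> vertices (star r K)" using S(2) by blast
      have cS: "card S = 3" "S \<subseteq> {1..7}" "S \<notin> block_triangles" using S(1) by (simp_all add: block_nonfaces_eq)
      have "card (place i ` S) = 3"
        using cS(1) by (simp add: card_place)
      then have "place i ` S \<in> glued_blocks k" using sub by (intro cl)
      moreover obtain y where y: "y \<in> place i ` S" "y \<noteq> 1" "y \<noteq> 2"
        by (rule three_set_meets[OF \<open>card (place i ` S) = 3\<close>])
      moreover have "y \<in> inner i" using y cS(2) place_image[of i] by blast
      \<comment> \<open>The private vertex \<open>y\<close> confines the triple to copy
        \<open>i\<close>, where injectivity would make \<open>S\<close> a triangle of the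
        block.\<close>
      ultimately have "place i ` S \<in> copy i" by (intro glued_blocks_inner(1)[of _ k y i])
      then show False using cS(3) inj_image_eq_iff[OF inj_place] by (auto simp: copy_def)
    qed
  qed
qed

section \<open>Nonfaces of the glued complex\<close>

definition nonfaces :: "nat \<Rightarrow> nat set set" where
  "nonfaces k = {T. T \<subseteq> {1..5 * k + 2} \<and> card T = 3 \<and> T \<notin> glued_blocks k}"

text \<open>The linear quotients of the block are carried over by \<open>place i\<close>.
  Complements of triples in seven points have four elements, within the bound of five for shedding
  faces.\<close>

lemma nonface_decomposable_copy:
  "nonface_decomposable 4 {T. T \<subseteq> {1, 2} \<union> inner i \<and> card T = 3 \<and> T \<notin> copy i}" (is "nonface_decomposable 4 ?N")
proof -
  have "?N = (`) (place i) ` set block_nonfaces"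
  proof (intro equalityI subsetI)
    fix T assume T: "T \<in> ?N"
    then obtain S where S: "S \<subseteq> {1..7}" "T = place i ` S"
      unfolding place_image[symmetric] by (auto simp: subset_image_iff)
    have "card S = 3"
      using T S(2) by (simp add: card_place)
    moreover have "S \<notin> block_triangles" using T S(2) by (auto simp: copy_def)
    ultimately show "T \<in> (`) (place i) ` set block_nonfaces" using S by (auto simp: block_nonfaces_eq)
  next
    fix T assume "T \<in> (`) (place i) ` set block_nonfaces"
    then obtain S where S: "S \<subseteq> {1..7}" "card S = 3" "S \<notin> block_triangles" "T = place i ` S"
      by (auto simp: block_nonfaces_eq)
    have "card T = 3"
      using S by (simp add: card_place)
    moreover have "T \<notin> copy i" using S inj_image_eq_iff[OF inj_place] by (auto simp: copy_def)
    ultimately show "T \<in> ?N" using S(1,4) place_image[of i] by blast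
  qed
  then have N: "?N = set (map ((`) (place i)) block_nonfaces)" by simp
  show ?thesis unfolding N
  proof (rule linear_quotients_nonface_decomposable)
    show "linear_quotients (map ((`) (place i)) block_nonfaces)"
      by (rule linear_quotients_map[OF inj_place linear_quotients_block_nonfaces])
    show "map ((`) (place i)) block_nonfaces \<noteq> []" by (simp add: block_nonfaces_def)
    show "finite ({1, 2} \<union> inner i)" by simp
    show "T \<subseteq> {1, 2} \<union> inner i \<and> card ({1, 2} \<union> inner i) \<le> card T + (4 + 1)"
      if "T \<in> set (map ((`) (place i)) block_nonfaces)" for T
      using that card_place[of i "{1..7}"]
      unfolding N[symmetric] place_image by simp
  qed
qed

text \<open>The parameter 4 is the dimension of the shedding face formed by the five private
  vertices of a copy.\<close>

lemma nonface_decomposable_nonfaces: "k \<ge> 1 \<Longrightarrow> nonface_decomposable 4 (nonfaces k)"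
proof (induction k rule: dec_induct)
  case base
  have "{1..5 * 1 + 2} = {1, 2} \<union> inner 0" by auto
  then show ?case using nonface_decomposable_copy[of 0] unfolding nonfaces_def glued_blocks_1 by simp
next
  case (step k)
  let ?N = "nonfaces (Suc k)" and ?U = "{1, 2} \<union> inner k" and ?V = "{3..5 * k + 2}"
  have W: "{1..5 * Suc k + 2} = ?U \<union> ?V" by auto
  have hit: "T \<inter> inner k \<noteq> {}" if T: "T \<in> copy k" for T
  proof -
    obtain x where "x \<in> T" "x \<noteq> 1" "x \<noteq> 2" by (rule three_set_meets[OF copy_subset(2)[OF T]])
    then show ?thesis using copy_subset(1)[OF T] by blast
  qed
  have L: "{T \<in> ?N. T \<inter> inner k = {}} = nonfaces k"
  proof (intro equalityI subsetI)
    fix T assume T: "T \<in> {T \<in> ?N. T \<inter> inner k = {}}"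
    then have "T \<subseteq> {1..5 * Suc k + 2} - inner k" by (auto simp: nonfaces_def)
    also have "\<dots> \<subseteq> {1..5 * k + 2}" by auto
    finally show "T \<in> nonfaces k" using T by (auto simp: nonfaces_def glued_blocks_Suc)
  next
    fix T assume T: "T \<in> nonfaces k"
    then have sub: "T \<subseteq> {1..5 * k + 2}" by (auto simp: nonfaces_def)
    then have dis: "T \<inter> inner k = {}" by (fastforce dest: subsetD)
    then have "T \<notin> copy k" using hit by blast
    moreover have "T \<subseteq> {1..5 * Suc k + 2}" using sub by (rule subset_trans) auto
    ultimately show "T \<in> {T \<in> ?N. T \<inter> inner k = {}}" using T dis by (auto simp: nonfaces_def glued_blocks_Suc)
  qed
  \<comment> \<open>A triangle with a vertex in \<open>inner k\<close> belongs to copy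
    \<open>k\<close>, so only the triangles of this copy are excluded among the triples meeting
    \<open>inner k\<close>.\<close>
  have M: "{T \<in> ?N. T \<inter> inner k \<noteq> {}} =
    {T. T \<subseteq> ?U \<union> ?V \<and> card T = 3 \<and> T \<inter> inner k \<noteq> {} \<and> T \<notin> copy k}"
  proof -
    have "T \<in> glued_blocks (Suc k) \<longleftrightarrow> T \<in> copy k" if "T \<inter> inner k \<noteq> {}" for T
      using that glued_blocks_inner(1)[of T "Suc k" _ k] by (auto simp: glued_blocks_Suc)
    then show ?thesis unfolding nonfaces_def W by blast
  qed
  \<comment> \<open>A triple inside a copy cannot fit into \<open>{1, 2}\<close>, so meeting
    \<open>inner k\<close> is automatic and the nonfaces of a single block remain.\<close>
  have base: "{T. T \<subseteq> ?U \<union> {} \<and> card T = 3 \<and> T \<inter> inner k \<noteq> {} \<and> T \<notin> copy k} =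
    {T. T \<subseteq> ?U \<and> card T = 3 \<and> T \<notin> copy k}"
  proof -
    have "T \<inter> inner k \<noteq> {}" if T: "T \<subseteq> ?U" "card T = 3" for T
    proof -
      obtain x where "x \<in> T" "x \<noteq> 1" "x \<noteq> 2" by (rule three_set_meets[OF T(2)])
      then show ?thesis using T(1) by blast
    qed
    then show ?thesis by auto
  qed
  show ?case
  proof (rule nonface_decomposable.shed[of "inner k"])
    show "nonface_decomposable 4 {T \<in> ?N. T \<inter> inner k = {}}" unfolding L by (rule step.IH)
    show "nonface_decomposable 4 {T \<in> ?N. T \<inter> inner k \<noteq> {}}"
      unfolding M
    proof (rule nonface_decomposable_mixed)
      show "nonface_decomposable 4 {T. T \<subseteq> ?U \<union> {} \<and> card T = 3 \<and> T \<inter> inner k \<noteq> {} \<and> T \<notin> copy k}"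
        unfolding base by (rule nonface_decomposable_copy)
      show "T \<subseteq> ?U" if "T \<in> copy k" for T using that by (rule copy_subset)
    qed auto
  next
    fix T s assume T: "T \<in> ?N" "T \<inter> inner k = {}" and s: "s \<in> inner k"
    have "T \<in> nonfaces k" using T L by blast
    then have c: "card T = 3" "T \<subseteq> {1..5 * k + 2}" by (auto simp: nonfaces_def)
    \<comment> \<open>\<open>z\<close> is private to an earlier copy and \<open>s\<close> to copy
      \<open>k\<close>, so no triangle contains both; \<open>y\<close> is any further point of
      \<open>T\<close>.\<close>
    obtain z where z: "z \<in> T" "z \<noteq> 1" "z \<noteq> 2" by (rule three_set_meets[OF c(1)])
    have "T \<noteq> {z}" using c(1) by auto
    then obtain y where y: "y \<in> T" "y \<noteq> z" using z(1) by auto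
    have "z \<in> {1..5 * k + 2}" "y \<in> {1..5 * k + 2}" using c(2) z y by auto
    then have "s \<noteq> z" "s \<noteq> y" "z \<notin> {1, 2} \<union> inner k" using s z by auto
    then have "card {s, z, y} = 3" using y by simp
    moreover have "{s, z, y} \<notin> glued_blocks (Suc k)"
    proof
      assume "{s, z, y} \<in> glued_blocks (Suc k)"
      from glued_blocks_inner(1)[OF this _ s] have "{s, z, y} \<in> copy k" by simp
      then show False using copy_subset(1) \<open>z \<notin> {1, 2} \<union> inner k\<close> by blast
    qed
    moreover have "{s, z, y} \<subseteq> {1..5 * Suc k + 2}"
      using s \<open>z \<in> {1..5 * k + 2}\<close> \<open>y \<in> {1..5 * k + 2}\<close> by auto
    ultimately have "{s, z, y} \<in> ?N" by (simp add: nonfaces_def)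
    then show "\<exists>T'\<in>?N. s \<in> T' \<and> T' \<subseteq> insert s T" using z y by (intro bexI[of _ "{s, z, y}"]) auto
  qed auto
qed

section \<open>The Alexander dual of the clique complex\<close>

text \<open>The complement of \<open>\<sigma>\<close> fails to be a clique exactly when it contains
  a triple \<open>T\<close> outside \<open>Fs\<close>, that is, when \<open>\<sigma>\<close> lies in
  the complement of \<open>T\<close>.\<close>

lemma alexander_dual_clique_complex:
  assumes "uniform 3 Fs"
  shows "alexander_dual n (clique_complex n 2 (generated Fs)) =
    dual_complex {1..n} {T. T \<subseteq> {1..n} \<and> card T = 3 \<and> T \<notin> Fs}"
proof -
  let ?N = "{T. T \<subseteq> {1..n} \<and> card T = 3 \<and> T \<notin> Fs}"
  have clique: "clique n 2 (generated Fs) V \<longleftrightarrow> V \<subseteq> {1..n} \<and> (\<forall>T\<subseteq>V. card T = 3 \<longrightarrow> T \<in> Fs)" for V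
    unfolding clique_def facets_generated[OF assms] by simp
  show ?thesis
  proof (intro equalityI subsetI)
    fix \<sigma> assume "\<sigma> \<in> alexander_dual n (clique_complex n 2 (generated Fs))"
    then obtain T where "\<sigma> \<subseteq> {1..n}" "T \<subseteq> {1..n} - \<sigma>" "card T = 3" "T \<notin> Fs"
      unfolding alexander_dual_def clique_complex_def clique mem_Collect_eq by blast
    moreover from this have "T \<in> ?N" "\<sigma> \<subseteq> {1..n} - T" by blast+
    ultimately show "\<sigma> \<in> dual_complex {1..n} ?N" unfolding mem_dual_complex by blast
  next
    fix \<sigma> assume "\<sigma> \<in> dual_complex {1..n} ?N"
    then obtain T where T: "T \<in> ?N" "\<sigma> \<subseteq> {1..n} - T" unfolding mem_dual_complex by (elim bexE)
    then have "T \<subseteq> {1..n} - \<sigma>" "\<sigma> \<subseteq> {1..n}" by blast+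
    then show "\<sigma> \<in> alexander_dual n (clique_complex n 2 (generated Fs))"
      unfolding alexander_dual_def clique_complex_def clique mem_Collect_eq using T(1) by blast
  qed
qed

theorem theoremA:
  fixes k :: nat
  assumes "k \<ge> 2"
  shows "\<exists>(n::nat) (\<Delta> :: nat set set).
    simplicial_complex \<Delta> \<and> vertices \<Delta> = {1..n} \<and>
    constructible 2 \<Delta> \<and>
    \<not> ridge_chordal n 2 \<Delta> \<and>
    pure_complex (5 * int k - 2) (alexander_dual n (clique_complex n 2 \<Delta>)) \<and>
    shellable (alexander_dual n (clique_complex n 2 \<Delta>)) \<and>
    decomposable 4 (alexander_dual n (clique_complex n 2 \<Delta>))"
proof (intro exI conjI)
  let ?n = "5 * k + 2" and ?K = "generated (glued_blocks k)"
  have k1: "k \<ge> 1" using assms by simp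
  show "simplicial_complex ?K"
    using uniform_glued_blocks[of k] by (intro simplicial_complex_generated) (auto simp: uniform_def)
  have "vertices ?K = \<Union>(glued_blocks k)" by (auto simp: vertices_def generated_def)
  then show "vertices ?K = {1..?n}" using vertices_glued_blocks[OF k1] by simp
  show "constructible 2 ?K" by (rule constructible_glued_blocks[OF k1])
  show "\<not> ridge_chordal ?n 2 ?K" by (rule not_ridge_chordal_glued_blocks[OF assms])
  have dual: "alexander_dual ?n (clique_complex ?n 2 ?K) = dual_complex {1..?n} (nonfaces k)"
    unfolding nonfaces_def by (rule alexander_dual_clique_complex[OF uniform_glued_blocks])
  have N: "T \<subseteq> {1..?n} \<and> card T = 3" if "T \<in> nonfaces k" for T
    using that by (simp add: nonfaces_def)
  have dec: "nonface_decomposable 4 (nonfaces k)" by (rule nonface_decomposable_nonfaces[OF k1])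
  then have ne: "nonfaces k \<noteq> {}" by (rule nonface_decomposable_nonempty)
  \<comment> \<open>Facets are complements of triples in \<open>5 * k + 2\<close> vertices, so they
    have \<open>5 * k - 1\<close> elements.\<close>
  have "int (card {1..?n} - 3) - 1 = 5 * int k - 2" using assms by simp
  then show "pure_complex (5 * int k - 2) (alexander_dual ?n (clique_complex ?n 2 ?K))"
    using pure_dual_complex[OF _ N ne] unfolding dual by simp
  \<comment> \<open>The shelling order is read off from the same decomposition that gives
    4-decomposability.\<close>
  obtain Ts where Ts: "set Ts = nonfaces k" "linear_quotients Ts"
    using nonface_decomposable_linear_quotients[OF dec] by blast
  have "shellable (dual_complex {1..?n} (set Ts))"
    using Ts ne N by (intro shellable_dual_complex) auto
  then show "shellable (alexander_dual ?n (clique_complex ?n 2 ?K))" unfolding dual Ts(1) .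
  show "decomposable 4 (alexander_dual ?n (clique_complex ?n 2 ?K))"
    unfolding dual by (rule decomposable_dual_complex[OF dec _ N]) simp_all
qed

end
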